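(* Let $\phi$ be a Neyman-Scott cluster process on $\mathbb{R}^2$ (with Poisson number of points per cluster), let $z\in\mathbb{R}^2$ and let $I_\phi(z)=\sum_{x\in\phi}h_x g(x-z)$, where $g$ is the path-loss function and the power fading coefficients $h_x$ are i.i.d. nonnegative random variables, independent of $\phi$, with Laplace transform $\mathcal{L}_h$. Then the conditional Laplace transform $\mathcal{L}_{I_\phi(z)}(s)=E_0^{!}\big[e^{-sI_\phi(z)}\big]$ of the interference is, for $s\ge 0$, $$\mathcal{L}_{I_\phi(z)}(s)=\mathcal{G}\big(\mathcal{L}_h(s\,g(\cdot-z))\big).$$
   Context: Neyman-Scott cluster process: the parents form a stationary Poisson point process $\phi_p$ on $\mathbb{R}^2$ of intensity $\lambda_p>0$; to each parent $x$ is attached an independent cluster with a Poisson number (mean $\bar c>0$) of points, located at $x$ plus i.i.d. displacements with isotropic density $f$; $\phi$ is the union of all clusters (parents not included), with intensity $\lambda=\lambda_p\bar c$. $E_0^{!}$ is expectation with respect to the reduced Palm distribution of $\phi$ at the origin (conditioning on a point of $\phi$ at the origin and removing it): $E_0^![F(\phi)]=\frac{1}{\lambda|B|}E\sum_{x\in\phi\cap B}F((\phi-x)\setminus\{0\})$ for any Borel $B$ of finite positive area; fading is independent of the point process. The conditional generating functional is $\mathcal{G}(v)=E_0^{!}\big(\prod_{x\in\phi}v(x)\big)$ for measurable $v:\mathbb{R}^2\to[0,1]$. $\mathcal{L}_h(s)=E[e^{-sh}]$, and $\mathcal{L}_h(s\,g(\cdot-z))$ is the function $x\mapsto\mathcal{L}_h(s\,g(x-z))$.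 The path-loss function $g:\mathbb{R}^2\setminus\{o\}\to\mathbb{R}^+$ is a continuous, positive, non-increasing function of $\|x\|$, with $\int_{\mathbb{R}^2\setminus B(o,\epsilon)}g(x)\,dx<\infty$ for all $\epsilon>0$, and $\lim_{\|x\|\to\infty}g(x)/g(x-y)=1$ for all $y\in\mathbb{R}^2$. *)

theory Defs
  imports "HOL-Probability.Probability"
begin

type_synonym plane = "real^2"

text \<open>
  A point process on a probability space \<open>M\<close> is a random set of points, i.e. a map from the sample
  space to \<open>plane set\<close>. The rate \<open>lam |B|\<close> may be zero, which the library distribution
  \<open>poisson_pmf\<close> does not cover, so the Poisson probabilities of the counts are written out.
\<close>

definition stationary_poisson_process ::
  "'a measure \<Rightarrow> real \<Rightarrow> ('a \<Rightarrow> plane set) \<Rightarrow> bool" where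
  "stationary_poisson_process M lam \<Phi> \<longleftrightarrow>
     (AE \<omega> in M. \<forall>B. bounded B \<longrightarrow> finite (\<Phi> \<omega> \<inter> B)) \<and>
     (\<forall>B. B \<in> sets borel \<and> bounded B \<longrightarrow>
        (\<lambda>\<omega>. card (\<Phi> \<omega> \<inter> B)) \<in> measurable M (count_space UNIV) \<and>
        (\<forall>k. measure M {\<omega> \<in> space M. card (\<Phi> \<omega> \<inter> B) = k}
              = (lam * measure lborel B) ^ k / fact k * exp (- (lam * measure lborel B)))) \<and>
     (\<forall>A :: nat \<Rightarrow> plane set.
        disjoint_family A \<and> (\<forall>i. A i \<in> sets borel \<and> bounded (A i)) \<longrightarrow>
        prob_space.indep_vars M (\<lambda>_. count_space UNIV) (\<lambda>i \<omega>. card (\<Phi> \<omega> \<inter> A i)) UNIV)"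

definition isotropic_density :: "(plane \<Rightarrow> real) \<Rightarrow> bool" where
  "isotropic_density f \<longleftrightarrow>
     f \<in> borel_measurable borel \<and> (\<forall>x. 0 \<le> f x) \<and> (\<integral>\<^sup>+x. ennreal (f x) \<partial>lborel) = 1 \<and>
     (\<forall>x y. norm x = norm y \<longrightarrow> f x = f y)"

text \<open>Unlike the library's \<open>indep_var\<close>, this allows two random elements of different types.\<close>

definition indep_elements ::
  "'a measure \<Rightarrow> 'b measure \<Rightarrow> ('a \<Rightarrow> 'b) \<Rightarrow> 'c measure \<Rightarrow> ('a \<Rightarrow> 'c) \<Rightarrow> bool" where
  "indep_elements M S X T Y \<longleftrightarrow>
     X \<in> measurable M S \<and> Y \<in> measurable M T \<and>
     prob_space.indep_set M {X -` A \<inter> space M | A. A \<in> sets S} {Y -` A \<inter> space M | A. A \<in> sets T}"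

text \<open>
  \<open>X i\<close> are the parents (infinitely many almost surely, since the intensity is positive), \<open>N i\<close> is
  the number of points in the cluster of \<open>X i\<close>, and \<open>D i j\<close> for \<open>j < N i\<close> are their displacements;
  the values \<open>D i j\<close> for \<open>j \<ge> N i\<close> are not used. The random elements \<open>(N i, D i)\<close> are
  independent of each other and of the whole sequence of parents.
\<close>

definition neyman_scott ::
  "'a measure \<Rightarrow> real \<Rightarrow> real \<Rightarrow> (plane \<Rightarrow> real) \<Rightarrow> ('a \<Rightarrow> plane set) \<Rightarrow> bool" where
  "neyman_scott M lamp c f \<Phi> \<longleftrightarrow>
     (\<exists>(X :: nat \<Rightarrow> 'a \<Rightarrow> plane) (N :: nat \<Rightarrow> 'a \<Rightarrow> nat) (D :: nat \<Rightarrow> nat \<Rightarrow> 'a \<Rightarrow> plane).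
        (\<forall>i. X i \<in> borel_measurable M) \<and>
        (AE \<omega> in M. inj (\<lambda>i. X i \<omega>)) \<and>
        stationary_poisson_process M lamp (\<lambda>\<omega>. range (\<lambda>i. X i \<omega>)) \<and>
        (\<forall>i. N i \<in> measurable M (count_space UNIV) \<and>
             distr M (count_space UNIV) (N i) = measure_pmf (poisson_pmf c)) \<and>
        (\<forall>i j. distributed M lborel (D i j) (\<lambda>x. ennreal (f x))) \<and>
        (\<forall>i. prob_space.indep_vars M (\<lambda>_. borel) (D i) UNIV) \<and>
        (\<forall>i. indep_elements M
               (count_space UNIV) (N i)
               (PiM UNIV (\<lambda>_. borel)) (\<lambda>\<omega> j. D i j \<omega>)) \<and>
        prob_space.indep_vars M
          (\<lambda>_. count_space UNIV \<Otimes>\<^sub>M PiM UNIV (\<lambda>_. borel)) (\<lambda>i \<omega>. (N i \<omega>, \<lambda>j. D i j \<omega>)) UNIV \<and>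
        indep_elements M
          (PiM UNIV (\<lambda>_. borel)) (\<lambda>\<omega> i. X i \<omega>)
          (PiM UNIV (\<lambda>_. count_space UNIV \<Otimes>\<^sub>M PiM UNIV (\<lambda>_. borel)))
            (\<lambda>\<omega> i. (N i \<omega>, \<lambda>j. D i j \<omega>)) \<and>
        (AE \<omega> in M. \<Phi> \<omega> = {X i \<omega> + D i j \<omega> | i j. j < N i \<omega>}))"

text \<open>
  \<open>h \<omega> x\<close> is the fading coefficient of the point \<open>x \<in> \<Phi> \<omega>\<close>; its values off \<open>\<Phi> \<omega>\<close> are
  irrelevant. Since an uncountable i.i.d. family cannot be evaluated measurably at random points,
  independence is expressed along a measurable enumeration \<open>\<xi>\<close> of the (almost surely infinite) point
  process: the marks read along \<open>\<xi>\<close> are i.i.d. with law \<open>\<mu>\<close> and independent of the enumerated points,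
  hence of \<open>\<Phi>\<close>.
\<close>

definition iid_fading ::
  "'a measure \<Rightarrow> real measure \<Rightarrow> ('a \<Rightarrow> plane set) \<Rightarrow> ('a \<Rightarrow> plane \<Rightarrow> real) \<Rightarrow> bool" where
  "iid_fading M \<mu> \<Phi> h \<longleftrightarrow>
     (\<exists>\<xi> :: nat \<Rightarrow> 'a \<Rightarrow> plane.
        (AE \<omega> in M. bij_betw (\<lambda>n. \<xi> n \<omega>) UNIV (\<Phi> \<omega>)) \<and>
        prob_space.indep_vars M (\<lambda>_. borel) (\<lambda>n \<omega>. h \<omega> (\<xi> n \<omega>)) UNIV \<and>
        (\<forall>n. distr M borel (\<lambda>\<omega>. h \<omega> (\<xi> n \<omega>)) = \<mu>) \<and>
        indep_elements M
          (PiM UNIV (\<lambda>_. borel)) (\<lambda>\<omega> n. \<xi> n \<omega>)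
          (PiM UNIV (\<lambda>_. borel)) (\<lambda>\<omega> n. h \<omega> (\<xi> n \<omega>)))"

text \<open>
  Reduced Palm expectation at the origin of a nonnegative functional, for a stationary process of
  intensity \<open>lam\<close>, computed with the Borel window \<open>B\<close> of finite positive area. In the marked version
  each point keeps its mark under translation, and the mark of the removed point is discarded
  with it.
\<close>

definition reduced_palm ::
  "'a measure \<Rightarrow> real \<Rightarrow> plane set \<Rightarrow> ('a \<Rightarrow> plane set) \<Rightarrow> (plane set \<Rightarrow> ennreal) \<Rightarrow> ennreal" where
  "reduced_palm M lam B \<Phi> F =
     (\<integral>\<^sup>+\<omega>. (\<Sum>\<^sub>\<infinity>x\<in>\<Phi> \<omega> \<inter> B. F ((\<lambda>y. y - x) ` \<Phi> \<omega> - {0})) \<partial>M)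
       / ennreal (lam * measure lborel B)"

definition marked_reduced_palm ::
  "'a measure \<Rightarrow> real \<Rightarrow> plane set \<Rightarrow> ('a \<Rightarrow> plane set) \<Rightarrow> ('a \<Rightarrow> plane \<Rightarrow> real) \<Rightarrow>
   (plane set \<Rightarrow> (plane \<Rightarrow> real) \<Rightarrow> ennreal) \<Rightarrow> ennreal" where
  "marked_reduced_palm M lam B \<Phi> h F =
     (\<integral>\<^sup>+\<omega>. (\<Sum>\<^sub>\<infinity>x\<in>\<Phi> \<omega> \<inter> B. F ((\<lambda>y. y - x) ` \<Phi> \<omega> - {0}) (\<lambda>y. h \<omega> (y + x))) \<partial>M)
       / ennreal (lam * measure lborel B)"

text \<open>
  For factors in \<open>[0,1]\<close> the finite partial products decrease, so the unordered infinite product is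
  their infimum (the value 0 being allowed).
\<close>

definition unordered_prod :: "(plane \<Rightarrow> real) \<Rightarrow> plane set \<Rightarrow> ennreal" where
  "unordered_prod v A = (INF F\<in>{F. finite F \<and> F \<subseteq> A}. \<Prod>x\<in>F. ennreal (v x))"

definition cond_gen_functional ::
  "'a measure \<Rightarrow> real \<Rightarrow> plane set \<Rightarrow> ('a \<Rightarrow> plane set) \<Rightarrow> (plane \<Rightarrow> real) \<Rightarrow> ennreal" where
  "cond_gen_functional M lam B \<Phi> v = reduced_palm M lam B \<Phi> (unordered_prod v)"

text \<open>The path loss is a function on the plane without the origin; \<open>g 0\<close> is left unconstrained.\<close>

definition path_loss :: "(plane \<Rightarrow> real) \<Rightarrow> bool" where
  "path_loss g \<longleftrightarrow>
     continuous_on (- {0}) g \<and>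
     (\<forall>x. x \<noteq> 0 \<longrightarrow> 0 < g x) \<and>
     (\<forall>x y. x \<noteq> 0 \<and> norm x \<le> norm y \<longrightarrow> g y \<le> g x) \<and>
     (\<forall>\<epsilon>>0. set_integrable lborel (- ball 0 \<epsilon>) g) \<and>
     (\<forall>y. ((\<lambda>x. g x / g (x - y)) \<longlongrightarrow> 1) at_infinity)"

definition laplace :: "real measure \<Rightarrow> real \<Rightarrow> real" where
  "laplace \<mu> s = (\<integral>t. exp (- s * t) \<partial>\<mu>)"

text \<open>
  The interference may be infinite (no moment of the fading is assumed), hence \<open>exp (- t)\<close> on
  \<open>[0,\<infinity>]\<close> with value 0 at \<open>\<infinity>\<close>.
\<close>

definition exp_neg :: "ennreal \<Rightarrow> ennreal" where
  "exp_neg t = (if t = \<infinity> then 0 else ennreal (exp (- enn2real t)))"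

definition interference ::
  "plane set \<Rightarrow> (plane \<Rightarrow> real) \<Rightarrow> (plane \<Rightarrow> real) \<Rightarrow> plane \<Rightarrow> ennreal" where
  "interference \<phi> h g z = (\<Sum>\<^sub>\<infinity>x\<in>\<phi>. ennreal (h x * g (x - z)))"

definition cond_laplace_interference ::
  "'a measure \<Rightarrow> real \<Rightarrow> plane set \<Rightarrow> ('a \<Rightarrow> plane set) \<Rightarrow> ('a \<Rightarrow> plane \<Rightarrow> real) \<Rightarrow>
   (plane \<Rightarrow> real) \<Rightarrow> plane \<Rightarrow> real \<Rightarrow> ennreal" where
  "cond_laplace_interference M lam B \<Phi> h g z s =
     marked_reduced_palm M lam B \<Phi> h (\<lambda>\<phi> k. exp_neg (ennreal s * interference \<phi> k g z))"

end

theory Submission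
  imports Defs
begin

text \<open>
  Read the points of \<open>\<Phi>\<close> and their marks along the enumeration \<open>\<xi>\<close>. Both Palm expectations become
  sums over \<open>n\<close> of expectations with \<open>\<xi> n\<close> as the centre. Given \<open>\<xi>\<close>, the marks are still i.i.d., so the
  expected value of \<open>exp (- s I)\<close>, a decreasing limit of finite products over the points other than
  \<open>\<xi> n\<close>, is the corresponding limit of products of Laplace transforms. Since \<open>g 0\<close> is arbitrary, one
  also needs that almost surely no two points of \<open>\<Phi>\<close> differ by \<open>z \<noteq> 0\<close>; this holds because the
  displacements have a density and are independent of each other and of the parents.
\<close>

section \<open>Unordered products and the exponential on \<open>[0,\<infinity>]\<close>\<close>

text \<open>The infimum of \<open>unordered_prod\<close>, over any index type and with extended
  factors, so that a product over points can be moved to a product over \<open>nat\<close>. It is a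
  genuine product for factors at most 1.\<close>

definition inf_prod :: "('b \<Rightarrow> ennreal) \<Rightarrow> 'b set \<Rightarrow> ennreal" where
  "inf_prod u A = (INF F\<in>{F. finite F \<and> F \<subseteq> A}. \<Prod>x\<in>F. u x)"

lemma unordered_prod_eq_inf_prod: "unordered_prod v A = inf_prod (\<lambda>x. ennreal (v x)) A"
  by (simp add: unordered_prod_def inf_prod_def)

lemma inf_prod_reindex:
  assumes "inj_on f A"
  shows "inf_prod u (f ` A) = inf_prod (\<lambda>x. u (f x)) A"
proof -
  have eq: "{F. finite F \<and> F \<subseteq> f ` A} = image f ` {F. finite F \<and> F \<subseteq> A}"
    by (auto simp: finite_subset_image image_iff) (metis finite_subset_image)
  have "prod u (f ` F) = (\<Prod>x\<in>F. u (f x))" if "F \<subseteq> A" for F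
    using inj_on_subset[OF assms that] by (simp add: prod.reindex)
  then show ?thesis
    unfolding inf_prod_def eq image_image by (intro INF_cong) auto
qed

lemma prod_ennreal_antimono:
  fixes u :: "'b \<Rightarrow> ennreal"
  assumes "finite G" "F \<subseteq> G" "\<And>x. x \<in> G \<Longrightarrow> u x \<le> 1"
  shows "prod u G \<le> prod u F"
proof -
  have "prod u (G - F) \<le> 1"
    using assms(3) by (intro prod_le_1) auto
  then have "prod u (G - F) * prod u F \<le> 1 * prod u F"
    by (rule mult_right_mono) simp
  then show ?thesis
    using prod.subset_diff[OF assms(2,1), of u] by simp
qed

text \<open>Every finite set of indices lies below some \<open>k\<close>, and enlarging a product of
  factors at most 1 decreases it. The uncountable-looking infimum thus becomes a sequential limit,
  fit for measurability and monotone convergence.\<close>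

lemma inf_prod_nat:
  fixes A :: "nat set"
  assumes "\<And>m. m \<in> A \<Longrightarrow> u m \<le> 1"
  shows "inf_prod u A = (INF k. \<Prod>m\<in>A \<inter> {..<k}. u m)"
  unfolding inf_prod_def
proof (rule INF_eq)
  fix F assume F: "F \<in> {F. finite F \<and> F \<subseteq> A}"
  then obtain k where "F \<subseteq> {..<k}"
    using finite_nat_iff_bounded by blast
  with F assms have "(\<Prod>m\<in>A \<inter> {..<k}. u m) \<le> prod u F"
    by (intro prod_ennreal_antimono) auto
  then show "\<exists>k\<in>UNIV. (\<Prod>m\<in>A \<inter> {..<k}. u m) \<le> prod u F" by blast
next
  fix k :: nat
  have "A \<inter> {..<k} \<in> {F. finite F \<and> F \<subseteq> A}" by auto
  then show "\<exists>F\<in>{F. finite F \<and> F \<subseteq> A}. prod u F \<le> (\<Prod>m\<in>A \<inter> {..<k}. u m)" by blast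
qed

lemma exp_neg_ennreal: "0 \<le> t \<Longrightarrow> exp_neg (ennreal t) = ennreal (exp (- t))"
  by (simp add: exp_neg_def)

lemma exp_neg_add: "exp_neg (a + b) = exp_neg a * exp_neg b"
  by (cases a; cases b)
    (simp_all add: exp_neg_def exp_add[symmetric] ennreal_mult[symmetric] ennreal_plus[symmetric]
      del: ennreal_plus)

lemma exp_neg_sum: "finite F \<Longrightarrow> exp_neg (sum a F) = (\<Prod>x\<in>F. exp_neg (a x))"
  by (induction F rule: finite_induct) (auto simp: exp_neg_add, simp add: exp_neg_def)

lemma exp_neg_le_1: "exp_neg a \<le> 1"
  by (cases a) (auto simp: exp_neg_def)

text \<open>Turns a positive lower bound on \<open>exp_neg\<close> into an upper bound on its
  argument, also at infinity; this replaces a continuity argument in the next lemmas.\<close>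

lemma ennreal_le_exp_neg_iff:
  assumes "0 < r" "r \<le> 1"
  shows "ennreal r \<le> exp_neg a \<longleftrightarrow> a \<le> ennreal (- ln r)"
proof (cases a)
  case (real t)
  have "r \<le> exp (- t) \<longleftrightarrow> t \<le> - ln r"
    using assms ln_ge_iff[of r "- t"] ln_le_cancel_iff[of r "exp (- t)"] by (simp) linarith
  then show ?thesis
    using real assms by (simp add: exp_neg_ennreal ennreal_le_iff)
next
  case top
  then show ?thesis using assms by (simp add: exp_neg_def top_unique)
qed

lemma exp_neg_antimono: "a \<le> b \<Longrightarrow> exp_neg b \<le> exp_neg a"
  by (cases a; cases b) (auto simp: exp_neg_def top_unique)

text \<open>If the infimum \<open>r\<close> is positive, \<open>- ln r\<close> bounds every
  \<open>a i\<close> and hence the supremum; if it is 0, nothing is to be shown. For empty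
  \<open>I\<close> the sides would be 1 and infinity.\<close>

lemma exp_neg_SUP:
  assumes "I \<noteq> {}"
  shows "exp_neg (SUP i\<in>I. a i) = (INF i\<in>I. exp_neg (a i))"
proof (rule antisym)
  show "exp_neg (SUP i\<in>I. a i) \<le> (INF i\<in>I. exp_neg (a i))"
    by (intro INF_greatest exp_neg_antimono SUP_upper)
next
  let ?L = "INF i\<in>I. exp_neg (a i)"
  have L1: "?L \<le> 1"
    using assms exp_neg_le_1 by (meson INF_lower2 ex_in_conv)
  then obtain r where r: "?L = ennreal r" "0 \<le> r"
    by (metis ennreal_cases ennreal_one_neq_top top_unique)
  show "?L \<le> exp_neg (SUP i\<in>I. a i)"
  proof (cases "r = 0")
    case True
    then show ?thesis using r by simp
  next
    case False
    with r L1 have r1: "0 < r" "r \<le> 1" by (auto simp flip: ennreal_1 simp: ennreal_le_iff)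
    have "a i \<le> ennreal (- ln r)" if "i \<in> I" for i
      using INF_lower[OF that, of "\<lambda>i. exp_neg (a i)"] ennreal_le_exp_neg_iff[OF r1] r(1) by simp
    then have "(SUP i\<in>I. a i) \<le> ennreal (- ln r)"
      by (rule SUP_least)
    then show ?thesis
      using ennreal_le_exp_neg_iff[OF r1] r(1) by simp
  qed
qed

text \<open>A nonnegative sum is the supremum of its finite partial sums, which
  \<open>exp_neg\<close> sends to the infimum of finite products. A divergent sum corresponds to the
  product 0.\<close>

lemma exp_neg_infsum: "exp_neg (\<Sum>\<^sub>\<infinity>x\<in>A. a x) = inf_prod (\<lambda>x. exp_neg (a x)) A"
proof -
  have "exp_neg (\<Sum>\<^sub>\<infinity>x\<in>A. a x) = (INF F\<in>{F. finite F \<and> F \<subseteq> A}. exp_neg (sum a F))"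
    by (subst nonneg_infsum_complete) (auto intro!: exp_neg_SUP)
  also have "\<dots> = inf_prod (\<lambda>x. exp_neg (a x)) A"
    unfolding inf_prod_def by (intro INF_cong) (auto simp: exp_neg_sum)
  finally show ?thesis .
qed

lemma ennreal_infsum_cmult:
  "(c :: ennreal) * (\<Sum>\<^sub>\<infinity>x\<in>A. a x) = (\<Sum>\<^sub>\<infinity>x\<in>A. c * a x)"
  by (simp add: nonneg_infsum_complete SUP_mult_left_ennreal sum_distrib_left)

section \<open>Interference and Palm sums along an enumeration\<close>

lemma exp_neg_interference:
  "exp_neg (ennreal s * interference A k g z)
     = inf_prod (\<lambda>x. exp_neg (ennreal s * ennreal (k x * g (x - z)))) A"
  by (simp add: interference_def ennreal_infsum_cmult exp_neg_infsum)

lemma infsum_nat_ennreal: "(\<Sum>\<^sub>\<infinity>n. a n) = (\<Sum>n. a n :: ennreal)"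
  by (metis has_sum_imp_sums has_sum_infsum nonneg_summable_on_complete sums_unique zero_le)

text \<open>Common form of both Palm integrands. The weight \<open>W a\<close> may depend on the
  centre \<open>a\<close>, as the shifted marks do. By injectivity, deleting the origin after
  recentring at \<open>x n\<close> is deleting the index \<open>n\<close>, so factors are controlled
  only for \<open>m\<close> other than \<open>n\<close>.\<close>

lemma palm_sum_enumerated:
  fixes x :: "nat \<Rightarrow> 'v::real_vector"
  assumes x: "bij_betw x UNIV \<Phi>"
    and le: "\<And>m n. m \<noteq> n \<Longrightarrow> W (x n) (x m - x n) \<le> 1"
  shows "(\<Sum>\<^sub>\<infinity>a\<in>\<Phi> \<inter> B. inf_prod (W a) ((\<lambda>y. y - a) ` \<Phi> - {0}))
    = (\<Sum>n. indicator B (x n) * (INF k. \<Prod>m\<in>{..<k} - {n}. W (x n) (x m - x n)))"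
proof -
  have inj: "inj x" and ran: "\<Phi> = range x"
    using x by (auto simp: bij_betw_def)
  have *: "inf_prod (W (x n)) ((\<lambda>y. y - x n) ` \<Phi> - {0})
      = (INF k. \<Prod>m\<in>{..<k} - {n}. W (x n) (x m - x n))" for n
  proof -
    have "(\<lambda>y. y - x n) ` \<Phi> - {0} = (\<lambda>m. x m - x n) ` (UNIV - {n})"
      using inj by (auto simp: ran inj_def)
    moreover have "inj_on (\<lambda>m. x m - x n) (UNIV - {n})"
      using inj by (auto simp: inj_on_def)
    ultimately have "inf_prod (W (x n)) ((\<lambda>y. y - x n) ` \<Phi> - {0})
        = inf_prod (\<lambda>m. W (x n) (x m - x n)) (UNIV - {n})"
      by (simp add: inf_prod_reindex)
    also have "\<dots> = (INF k. \<Prod>m\<in>(UNIV - {n}) \<inter> {..<k}. W (x n) (x m - x n))"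
      using le by (intro inf_prod_nat) auto
    also have "(\<lambda>k. (UNIV - {n}) \<inter> {..<k}) = (\<lambda>k. {..<k} - {n})" by auto
    finally show ?thesis .
  qed
  have "\<Phi> \<inter> B = x ` {n. x n \<in> B}" by (auto simp: ran)
  moreover have "inj_on x {n. x n \<in> B}" using inj by (rule inj_on_subset) simp
  ultimately have "(\<Sum>\<^sub>\<infinity>a\<in>\<Phi> \<inter> B. inf_prod (W a) ((\<lambda>y. y - a) ` \<Phi> - {0}))
      = (\<Sum>\<^sub>\<infinity>n\<in>{n. x n \<in> B}. INF k. \<Prod>m\<in>{..<k} - {n}. W (x n) (x m - x n))"
    by (simp add: infsum_reindex o_def *)
  also have "\<dots> = (\<Sum>\<^sub>\<infinity>n. indicator B (x n) * (INF k. \<Prod>m\<in>{..<k} - {n}. W (x n) (x m - x n)))"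
    by (rule infsum_cong_neutral) auto
  finally show ?thesis by (simp add: infsum_nat_ennreal)
qed

section \<open>Independent random elements\<close>

text \<open>Independence makes the joint law the product of the marginals, as checked on rectangles;
  then Tonelli applies. The inner integral freezes \<open>X \<omega>\<close> and averages over
  \<open>Y\<close> alone.\<close>

lemma (in prob_space) nn_integral_indep_elements:
  assumes ind: "indep_elements M S X T Y"
    and F: "F \<in> borel_measurable (S \<Otimes>\<^sub>M T)"
  shows "(\<integral>\<^sup>+\<omega>. F (X \<omega>, Y \<omega>) \<partial>M) = (\<integral>\<^sup>+\<omega>. (\<integral>\<^sup>+\<omega>'. F (X \<omega>, Y \<omega>') \<partial>M) \<partial>M)"
proof -
  have X[measurable]: "X \<in> measurable M S" and Y[measurable]: "Y \<in> measurable M T"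
    and indS: "indep_set {X -` A \<inter> space M | A. A \<in> sets S} {Y -` A \<inter> space M | A. A \<in> sets T}"
    using ind by (auto simp: indep_elements_def)
  note F[measurable]
  interpret X: prob_space "distr M S X" by (rule prob_space_distr) fact
  interpret Y: prob_space "distr M T Y" by (rule prob_space_distr) fact
  have eq: "distr M S X \<Otimes>\<^sub>M distr M T Y = distr M (S \<Otimes>\<^sub>M T) (\<lambda>\<omega>. (X \<omega>, Y \<omega>))"
  proof (rule pair_measure_eqI)
    show "sigma_finite_measure (distr M S X)" "sigma_finite_measure (distr M T Y)"
      by unfold_locales
  next
    fix A C assume "A \<in> sets (distr M S X)" "C \<in> sets (distr M T Y)"
    then have [measurable]: "A \<in> sets S" "C \<in> sets T" by auto
    have "prob ((X -` A \<inter> space M) \<inter> (Y -` C \<inter> space M))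
        = prob (X -` A \<inter> space M) * prob (Y -` C \<inter> space M)"
      by (rule indep_setD[OF indS]) auto
    moreover have "(\<lambda>\<omega>. (X \<omega>, Y \<omega>)) -` (A \<times> C) \<inter> space M
        = (X -` A \<inter> space M) \<inter> (Y -` C \<inter> space M)" by auto
    ultimately show "emeasure (distr M S X) A * emeasure (distr M T Y) C
        = emeasure (distr M (S \<Otimes>\<^sub>M T) (\<lambda>\<omega>. (X \<omega>, Y \<omega>))) (A \<times> C)"
      by (simp add: emeasure_distr emeasure_eq_measure ennreal_mult)
  qed (simp cong: sets_pair_measure_cong)
  have "(\<integral>\<^sup>+\<omega>. F (X \<omega>, Y \<omega>) \<partial>M) = (\<integral>\<^sup>+p. F p \<partial>(distr M S X \<Otimes>\<^sub>M distr M T Y))"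
    by (simp add: eq nn_integral_distr)
  also have "\<dots> = (\<integral>\<^sup>+x. (\<integral>\<^sup>+y. F (x, y) \<partial>distr M T Y) \<partial>distr M S X)"
    by (rule Y.nn_integral_fst[symmetric]) (simp cong: measurable_cong_sets sets_pair_measure_cong)
  also have "\<dots> = (\<integral>\<^sup>+\<omega>. (\<integral>\<^sup>+y. F (X \<omega>, y) \<partial>distr M T Y) \<partial>M)"
    by (rule nn_integral_distr) (auto cong: measurable_cong_sets)
  also have "\<dots> = (\<integral>\<^sup>+\<omega>. (\<integral>\<^sup>+\<omega>'. F (X \<omega>, Y \<omega>') \<partial>M) \<partial>M)"
  proof (rule nn_integral_cong)
    fix \<omega> assume "\<omega> \<in> space M"
    then have "X \<omega> \<in> space S" using X by (rule measurable_space[rotated])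
    then show "(\<integral>\<^sup>+y. F (X \<omega>, y) \<partial>distr M T Y) = (\<integral>\<^sup>+\<omega>'. F (X \<omega>, Y \<omega>') \<partial>M)"
      by (intro nn_integral_distr) (auto cong: measurable_cong_sets)
  qed
  finally show ?thesis .
qed

text \<open>Almost sure statements may be checked with \<open>X\<close> frozen: integrate the
  indicator of the exceptional set.\<close>

lemma (in prob_space) AE_indep_elements:
  assumes ind: "indep_elements M S X T Y"
    and P: "Measurable.pred (S \<Otimes>\<^sub>M T) P"
    and AE: "\<And>\<omega>. \<omega> \<in> space M \<Longrightarrow> AE \<omega>' in M. P (X \<omega>, Y \<omega>')"
  shows "AE \<omega> in M. P (X \<omega>, Y \<omega>)"
proof -
  have [measurable]: "X \<in> measurable M S" "Y \<in> measurable M T"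
    using ind by (auto simp: indep_elements_def)
  note P[measurable]
  have "(\<integral>\<^sup>+\<omega>. indicator {p. \<not> P p} (X \<omega>, Y \<omega>) \<partial>M)
      = (\<integral>\<^sup>+\<omega>. (\<integral>\<^sup>+\<omega>'. indicator {p. \<not> P p} (X \<omega>, Y \<omega>') \<partial>M) \<partial>M)"
    using ind by (rule nn_integral_indep_elements) measurable
  also have "\<dots> = (\<integral>\<^sup>+\<omega>. 0 \<partial>M)"
  proof (rule nn_integral_cong)
    fix \<omega> assume "\<omega> \<in> space M"
    from AE[OF this] have "AE \<omega>' in M. indicator {p. \<not> P p} (X \<omega>, Y \<omega>') = (0::ennreal)"
      by eventually_elim simp
    then show "(\<integral>\<^sup>+\<omega>'. indicator {p. \<not> P p} (X \<omega>, Y \<omega>') \<partial>M) = 0"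
      by (subst nn_integral_cong_AE[where v = "\<lambda>_. 0"]) auto
  qed
  finally have "(\<integral>\<^sup>+\<omega>. indicator {p. \<not> P p} (X \<omega>, Y \<omega>) \<partial>M) = (0::ennreal)" by simp
  then have "AE \<omega> in M. indicator {p. \<not> P p} (X \<omega>, Y \<omega>) = (0::ennreal)"
    by (subst (asm) nn_integral_0_iff_AE) measurable
  then show ?thesis by eventually_elim (simp add: indicator_def split: if_splits)
qed

lemma (in prob_space) indep_elements_of_indep_vars:
  assumes "indep_vars N X I" "i \<in> I" "j \<in> I" "i \<noteq> j"
  shows "indep_elements M (N i) (X i) (N j) (X j)"
  unfolding indep_elements_def indep_sets2_eq
proof (intro conjI ballI)
  have rv: "random_variable (N i) (X i)" if "i \<in> I" for i
    using assms(1) that by (auto simp: indep_vars_def)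
  then show "random_variable (N i) (X i)" "random_variable (N j) (X j)"
    using assms by auto
  then show "{X i -` A \<inter> space M |A. A \<in> sets (N i)} \<subseteq> events"
    "{X j -` A \<inter> space M |A. A \<in> sets (N j)} \<subseteq> events"
    by (auto intro: measurable_sets)
  fix a b assume a: "a \<in> {X i -` A \<inter> space M |A. A \<in> sets (N i)}"
    and b: "b \<in> {X j -` A \<inter> space M |A. A \<in> sets (N j)}"
  have "indep_sets (\<lambda>i. {X i -` A \<inter> space M |A. A \<in> sets (N i)}) I"
    using assms(1) by (simp add: indep_vars_def2)
  from indep_setsD[OF this, of "{i, j}" "\<lambda>k. if k = i then a else b"] assms(2-4) a b
  show "prob (a \<inter> b) = prob a * prob b" by (auto simp: Int_commute)
qed

text \<open>A law with a density has no atoms, since singletons are Lebesgue null.\<close>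

lemma AE_distributed_lborel_neq:
  fixes U :: "'a \<Rightarrow> 'v::euclidean_space"
  assumes "distributed M lborel U f"
  shows "AE \<omega> in M. U \<omega> \<noteq> w"
proof -
  have "AE x in density lborel f. x \<noteq> w"
    using AE_lborel_singleton[of w] distributed_borel_measurable[OF assms] by (auto simp: AE_density)
  then have "AE x in distr M lborel U. x \<noteq> w"
    by (simp only: distributed_distr_eq_density[OF assms])
  then show ?thesis
    using distributed_measurable[OF assms] by (subst (asm) AE_distr_iff) auto
qed

section \<open>No two points of a Neyman--Scott process differ by a fixed vector\<close>

text \<open>With \<open>U\<close> frozen, \<open>V\<close> has to avoid just the one point
  \<open>w + U \<omega>\<close>.\<close>

lemma (in prob_space) AE_indep_density_diff:
  fixes U V :: "'a \<Rightarrow> plane"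
  assumes "indep_elements M borel U borel V" "distributed M lborel V f"
  shows "AE \<omega> in M. V \<omega> - U \<omega> \<noteq> w"
proof -
  have "AE \<omega> in M. case (U \<omega>, V \<omega>) of (u, v) \<Rightarrow> v - u \<noteq> w"
  proof (rule AE_indep_elements[OF assms(1)])
    show "AE \<omega>' in M. case (U \<omega>, V \<omega>') of (u, v) \<Rightarrow> v - u \<noteq> w" for \<omega>
      using AE_distributed_lborel_neq[OF assms(2), of "w + U \<omega>"] by eventually_elim auto
  qed measurable
  then show ?thesis by simp
qed

text \<open>Distinct points carry distinct index pairs, and there are countably many pairs of these,
  so it suffices to exclude the difference \<open>z\<close> for one pair at a time.\<close>

lemma (in prob_space) neyman_scott_AE_diff:
  assumes "neyman_scott M lamp c f \<Phi>"
  shows "AE \<omega> in M. \<forall>x\<in>\<Phi> \<omega>. \<forall>y\<in>\<Phi> \<omega>. x \<noteq> y \<longrightarrow> y - x \<noteq> z"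
proof -
  from assms obtain X :: "nat \<Rightarrow> 'a \<Rightarrow> plane" and N :: "nat \<Rightarrow> 'a \<Rightarrow> nat"
    and D :: "nat \<Rightarrow> nat \<Rightarrow> 'a \<Rightarrow> plane" where
    dens: "\<And>i j. distributed M lborel (D i j) (\<lambda>x. ennreal (f x))"
    and indD: "\<And>i. indep_vars (\<lambda>_. borel) (D i) UNIV"
    and indC: "indep_vars (\<lambda>_. count_space UNIV \<Otimes>\<^sub>M PiM UNIV (\<lambda>_. borel))
          (\<lambda>i \<omega>. (N i \<omega>, \<lambda>j. D i j \<omega>)) UNIV"
    and indX: "indep_elements M
          (PiM UNIV (\<lambda>_. borel)) (\<lambda>\<omega> i. X i \<omega>)
          (PiM UNIV (\<lambda>_. count_space UNIV \<Otimes>\<^sub>M PiM UNIV (\<lambda>_. borel)))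
            (\<lambda>\<omega> i. (N i \<omega>, \<lambda>j. D i j \<omega>))"
    and Phi: "AE \<omega> in M. \<Phi> \<omega> = {X i \<omega> + D i j \<omega> | i j. j < N i \<omega>}"
    unfolding neyman_scott_def by blast
  have indDD: "indep_elements M borel (D i j) borel (D k l)" if "(i, j) \<noteq> (k, l)" for i j k l
  proof (cases "i = k")
    case True
    then show ?thesis
      using that indep_elements_of_indep_vars[OF indD[of k], of j l] by auto
  next
    case False
    \<comment> \<open>\<open>jj\<close> picks the coordinate read from each cluster:
      \<open>j\<close> from cluster \<open>i\<close> and \<open>l\<close> from all others, in
      particular from \<open>k\<close>. Projecting the independent clusters this way gives
      independence of the two displacements.\<close>
    define jj where "jj m = (if m = i then j else l)" for m
    have "indep_vars (\<lambda>_. borel) (\<lambda>m \<omega>. snd (N m \<omega>, \<lambda>j. D m j \<omega>) (jj m)) UNIV"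
      by (rule indep_vars_compose2[OF indC]) measurable
    from indep_elements_of_indep_vars[OF this, of i k] False show ?thesis
      by (simp add: jj_def)
  qed
  have sep: "AE \<omega> in M. (X k \<omega> + D k l \<omega>) - (X i \<omega> + D i j \<omega>) \<noteq> z" if "(i, j) \<noteq> (k, l)" for i j k l
  proof -
    have "AE \<omega> in M. case (\<lambda>i. X i \<omega>, \<lambda>i. (N i \<omega>, \<lambda>j. D i j \<omega>)) of
        (x, d) \<Rightarrow> (x k + snd (d k) l) - (x i + snd (d i) j) \<noteq> z"
    proof (rule AE_indep_elements[OF indX])
      fix \<omega>
      \<comment> \<open>The parents are constants here and merely shift the vector that the
        difference of displacements has to avoid.\<close>
      show "AE \<omega>' in M. case (\<lambda>i. X i \<omega>, \<lambda>i. (N i \<omega>', \<lambda>j. D i j \<omega>')) of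
        (x, d) \<Rightarrow> (x k + snd (d k) l) - (x i + snd (d i) j) \<noteq> z"
        using AE_indep_density_diff[OF indDD[OF that] dens, of "z - X k \<omega> + X i \<omega>"]
        by eventually_elim (auto simp: algebra_simps)
    qed measurable
    then show ?thesis by simp
  qed
  \<comment> \<open>All \<open>j\<close> and \<open>l\<close> are covered, including those beyond
    the cluster sizes, so the random sizes need no conditioning.\<close>
  have "AE \<omega> in M. \<forall>i j k l. (i, j) \<noteq> (k, l) \<longrightarrow> (X k \<omega> + D k l \<omega>) - (X i \<omega> + D i j \<omega>) \<noteq> z"
    using sep by (simp add: AE_all_countable)
  with Phi show ?thesis
  proof eventually_elim
    case (elim \<omega>)
    show ?case
    proof (intro ballI impI)
      fix x y assume "x \<in> \<Phi> \<omega>" "y \<in> \<Phi> \<omega>" "x \<noteq> y"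
      then obtain i j k l where "x = X i \<omega> + D i j \<omega>" "y = X k \<omega> + D k l \<omega>"
        unfolding elim(1) by blast
      moreover from this \<open>x \<noteq> y\<close> have "(i, j) \<noteq> (k, l)" by auto
      ultimately show "y - x \<noteq> z" using elim(2) by blast
    qed
  qed
qed

section \<open>Averaging over the marks\<close>

text \<open>Here the points are fixed and \<open>\<psi> m\<close> is the factor of the point with
  index \<open>m\<close>; the centre \<open>n\<close> is left out. Partial products decrease, so the
  limit leaves the integral, and independence factorises each finite product.\<close>

lemma (in prob_space) nn_integral_prod_iid_marks:
  fixes H :: "nat \<Rightarrow> 'a \<Rightarrow> real" and \<psi> :: "nat \<Rightarrow> real \<Rightarrow> ennreal"
  assumes ind: "indep_vars (\<lambda>_. borel) H UNIV"
    and \<mu>: "\<And>m. distr M borel (H m) = \<mu>"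
    and \<psi>[measurable]: "\<And>m. \<psi> m \<in> borel_measurable borel"
    and le: "\<And>m t. \<psi> m t \<le> 1"
  shows "(\<integral>\<^sup>+\<omega>. (INF k. \<Prod>m\<in>{..<k} - {n}. \<psi> m (H m \<omega>)) \<partial>M)
     = (INF k. \<Prod>m\<in>{..<k} - {n}. \<integral>\<^sup>+t. \<psi> m t \<partial>\<mu>)"
proof -
  have H[measurable]: "H m \<in> borel_measurable M" for m
    using ind by (auto simp: indep_vars_def)
  have "(\<integral>\<^sup>+\<omega>. (INF k. \<Prod>m\<in>{..<k} - {n}. \<psi> m (H m \<omega>)) \<partial>M)
      = (INF k. \<integral>\<^sup>+\<omega>. (\<Prod>m\<in>{..<k} - {n}. \<psi> m (H m \<omega>)) \<partial>M)"
  \<comment> \<open>Downward monotone convergence requires a finite integral somewhere: at index 0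
    the product is empty and its integral is 1.\<close>
  proof (rule nn_integral_monotone_convergence_INF_decseq[where i = 0])
    show "decseq (\<lambda>k \<omega>. \<Prod>m\<in>{..<k} - {n}. \<psi> m (H m \<omega>))"
      by (auto simp: antimono_def monotone_on_def le_fun_def intro!: prod_ennreal_antimono le)
  qed (auto simp: emeasure_space_1)
  also have "\<dots> = (INF k. \<Prod>m\<in>{..<k} - {n}. \<integral>\<^sup>+t. \<psi> m t \<partial>\<mu>)"
  proof (rule INF_cong[OF refl])
    fix k
    have "indep_vars (\<lambda>_. borel) (\<lambda>m \<omega>. \<psi> m (H m \<omega>)) ({..<k} - {n})"
      by (rule indep_vars_compose2[OF indep_vars_subset[OF ind]]) auto
    then have "(\<integral>\<^sup>+\<omega>. (\<Prod>m\<in>{..<k} - {n}. \<psi> m (H m \<omega>)) \<partial>M)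
        = (\<Prod>m\<in>{..<k} - {n}. \<integral>\<^sup>+\<omega>. \<psi> m (H m \<omega>) \<partial>M)"
      by (intro indep_vars_nn_integral) auto
    also have "\<dots> = (\<Prod>m\<in>{..<k} - {n}. \<integral>\<^sup>+t. \<psi> m t \<partial>\<mu>)"
    proof (rule prod.cong[OF refl])
      show "(\<integral>\<^sup>+\<omega>. \<psi> m (H m \<omega>) \<partial>M) = (\<integral>\<^sup>+t. \<psi> m t \<partial>\<mu>)" for m
        unfolding \<mu>[of m, symmetric] by (simp add: nn_integral_distr)
    qed
    finally show "(\<integral>\<^sup>+\<omega>. (\<Prod>m\<in>{..<k} - {n}. \<psi> m (H m \<omega>)) \<partial>M)
        = (\<Prod>m\<in>{..<k} - {n}. \<integral>\<^sup>+t. \<psi> m t \<partial>\<mu>)" .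
  qed
  finally show ?thesis .
qed

text \<open>The series is nonnegative, so each centre \<open>n\<close> can be treated separately.
  Freezing all points makes the indicator a constant and leaves a product over i.i.d. marks.\<close>

lemma (in prob_space) nn_integral_palm_iid_marks:
  fixes \<xi> :: "nat \<Rightarrow> 'a \<Rightarrow> plane" and H :: "nat \<Rightarrow> 'a \<Rightarrow> real"
    and \<phi> :: "plane \<Rightarrow> real \<Rightarrow> ennreal"
  assumes ind: "indep_vars (\<lambda>_. borel) H UNIV"
    and \<mu>: "\<And>m. distr M borel (H m) = \<mu>"
    and indX: "indep_elements M (PiM UNIV (\<lambda>_. borel)) (\<lambda>\<omega> n. \<xi> n \<omega>)
          (PiM UNIV (\<lambda>_. borel)) (\<lambda>\<omega> n. H n \<omega>)"
    and \<phi>: "(\<lambda>p. \<phi> (fst p) (snd p)) \<in> borel_measurable (borel \<Otimes>\<^sub>M borel)"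
    and le: "\<And>b t. \<phi> b t \<le> 1"
    and B: "B \<in> sets borel"
  shows "(\<integral>\<^sup>+\<omega>. (\<Sum>n. indicator B (\<xi> n \<omega>) *
             (INF k. \<Prod>m\<in>{..<k} - {n}. \<phi> (\<xi> m \<omega> - \<xi> n \<omega>) (H m \<omega>))) \<partial>M)
    = (\<integral>\<^sup>+\<omega>. (\<Sum>n. indicator B (\<xi> n \<omega>) *
             (INF k. \<Prod>m\<in>{..<k} - {n}. \<integral>\<^sup>+t. \<phi> (\<xi> m \<omega> - \<xi> n \<omega>) t \<partial>\<mu>)) \<partial>M)"
proof -
  have "(\<lambda>\<omega>. \<lambda>n. \<xi> n \<omega>) \<in> measurable M (PiM UNIV (\<lambda>_. borel))"
    using indX by (simp add: indep_elements_def)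
  from measurable_compose[OF this measurable_component_singleton]
  have \<xi>[measurable]: "\<xi> n \<in> borel_measurable M" for n by simp
  have H[measurable]: "H m \<in> borel_measurable M" for m
    using ind by (auto simp: indep_vars_def)
  interpret \<mu>: prob_space \<mu>
    unfolding \<mu>[of 0, symmetric] by (rule prob_space_distr) simp
  have [measurable_cong]: "sets \<mu> = sets borel"
    by (simp add: \<mu>[of 0, symmetric])
  note B[measurable]
  have \<phi>'[measurable (raw)]: "(\<lambda>x. \<phi> (u x) (v x)) \<in> borel_measurable L"
    if "u \<in> borel_measurable L" "v \<in> borel_measurable L" for u v and L :: "'z measure"
    using measurable_compose[OF measurable_Pair[OF that] \<phi>] by simp
  have *: "(\<integral>\<^sup>+\<omega>. indicator B (\<xi> n \<omega>) *
             (INF k. \<Prod>m\<in>{..<k} - {n}. \<phi> (\<xi> m \<omega> - \<xi> n \<omega>) (H m \<omega>)) \<partial>M)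
    = (\<integral>\<^sup>+\<omega>. indicator B (\<xi> n \<omega>) *
             (INF k. \<Prod>m\<in>{..<k} - {n}. \<integral>\<^sup>+t. \<phi> (\<xi> m \<omega> - \<xi> n \<omega>) t \<partial>\<mu>) \<partial>M)" for n
  proof -
    \<comment> \<open>The summand as a functional of the whole point sequence and the whole mark
      sequence, the two independent elements.\<close>
    let ?F = "\<lambda>(x, t). indicator B (x n) *
             (INF k. \<Prod>m\<in>{..<k} - {n}. \<phi> (x m - x n) (t m)) :: ennreal"
    have "(\<integral>\<^sup>+\<omega>. ?F (\<lambda>n. \<xi> n \<omega>, \<lambda>n. H n \<omega>) \<partial>M)
        = (\<integral>\<^sup>+\<omega>. (\<integral>\<^sup>+\<omega>'. ?F (\<lambda>n. \<xi> n \<omega>, \<lambda>n. H n \<omega>') \<partial>M) \<partial>M)"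
      using indX by (rule nn_integral_indep_elements) measurable
    also have "\<dots> = (\<integral>\<^sup>+\<omega>. indicator B (\<xi> n \<omega>) *
             (INF k. \<Prod>m\<in>{..<k} - {n}. \<integral>\<^sup>+t. \<phi> (\<xi> m \<omega> - \<xi> n \<omega>) t \<partial>\<mu>) \<partial>M)"
    proof (rule nn_integral_cong)
      fix \<omega>
      have "(\<integral>\<^sup>+\<omega>'. (INF k. \<Prod>m\<in>{..<k} - {n}. \<phi> (\<xi> m \<omega> - \<xi> n \<omega>) (H m \<omega>')) \<partial>M)
          = (INF k. \<Prod>m\<in>{..<k} - {n}. \<integral>\<^sup>+t. \<phi> (\<xi> m \<omega> - \<xi> n \<omega>) t \<partial>\<mu>)"
        by (rule nn_integral_prod_iid_marks[OF ind \<mu> _ le]) (rule \<phi>', simp_all)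
      then show "(\<integral>\<^sup>+\<omega>'. ?F (\<lambda>n. \<xi> n \<omega>, \<lambda>n. H n \<omega>') \<partial>M) = indicator B (\<xi> n \<omega>) *
          (INF k. \<Prod>m\<in>{..<k} - {n}. \<integral>\<^sup>+t. \<phi> (\<xi> m \<omega> - \<xi> n \<omega>) t \<partial>\<mu>)"
        by (simp add: nn_integral_cmult)
    qed
    finally show ?thesis by simp
  qed
  show ?thesis
    by (subst (1 2) nn_integral_suminf) (measurable, simp add: *)
qed

section \<open>The conditional Laplace transform of the interference\<close>

theorem lemma2:
  fixes M :: "'a measure" and \<mu> :: "real measure"
    and \<Phi> :: "'a \<Rightarrow> plane set" and h :: "'a \<Rightarrow> plane \<Rightarrow> real"
    and f g :: "plane \<Rightarrow> real" and lamp c s :: real and z :: plane and B :: "plane set"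
  assumes "prob_space M"
    and "0 < lamp" and "0 < c" and "isotropic_density f"
    and "neyman_scott M lamp c f \<Phi>"
    and "iid_fading M \<mu> \<Phi> h" and "AE t in \<mu>. 0 \<le> t"
    and "path_loss g"
    and "0 \<le> s"
    and "B \<in> sets borel" and "0 < emeasure lborel B" and "emeasure lborel B < \<infinity>"
  shows "cond_laplace_interference M (lamp * c) B \<Phi> h g z s
           = cond_gen_functional M (lamp * c) B \<Phi> (\<lambda>x. laplace \<mu> (s * g (x - z)))"
proof -
  interpret prob_space M by fact
  from \<open>iid_fading M \<mu> \<Phi> h\<close> obtain \<xi> :: "nat \<Rightarrow> 'a \<Rightarrow> plane" where
    bij: "AE \<omega> in M. bij_betw (\<lambda>n. \<xi> n \<omega>) UNIV (\<Phi> \<omega>)"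
    and ind: "indep_vars (\<lambda>_. borel) (\<lambda>n \<omega>. h \<omega> (\<xi> n \<omega>)) UNIV"
    and \<mu>: "\<And>n. distr M borel (\<lambda>\<omega>. h \<omega> (\<xi> n \<omega>)) = \<mu>"
    and indX: "indep_elements M
          (PiM UNIV (\<lambda>_. borel)) (\<lambda>\<omega> n. \<xi> n \<omega>)
          (PiM UNIV (\<lambda>_. borel)) (\<lambda>\<omega> n. h \<omega> (\<xi> n \<omega>))"
    unfolding iid_fading_def by blast
  have hm[measurable]: "(\<lambda>\<omega>. h \<omega> (\<xi> n \<omega>)) \<in> borel_measurable M" for n
    using ind by (auto simp: indep_vars_def)
  interpret \<mu>: prob_space \<mu>
    unfolding \<mu>[of 0, symmetric] by (rule prob_space_distr) simp
  have sets_\<mu>[measurable_cong]: "sets \<mu> = sets borel"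
    by (simp add: \<mu>[of 0, symmetric])
  \<comment> \<open>Continuity fails at most at the origin, and a countable exceptional set does not
    affect Borel measurability.\<close>
  have [measurable]: "g \<in> borel_measurable borel"
    using \<open>path_loss g\<close> unfolding path_loss_def
    by (intro borel_measurable_continuous_countable_exceptions[of "{0}"]) auto
  have gpos: "0 < g x" if "x \<noteq> 0" for x
    using \<open>path_loss g\<close> that by (simp add: path_loss_def)
  have hpos: "AE \<omega> in M. \<forall>n. 0 \<le> h \<omega> (\<xi> n \<omega>)"
  proof (subst AE_all_countable, rule allI)
    fix n
    show "AE \<omega> in M. 0 \<le> h \<omega> (\<xi> n \<omega>)"
      using \<open>AE t in \<mu>. 0 \<le> t\<close> unfolding \<mu>[of n, symmetric] by (simp add: AE_distr_iff)
  qed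

  \<comment> \<open>The positive parts make \<open>\<phi>\<close> bounded by 1 everywhere, also where \<open>g 0\<close> or a negative mark
    would enter.\<close>
  define \<phi> :: "plane \<Rightarrow> real \<Rightarrow> ennreal" where
    "\<phi> b t = ennreal (exp (- (s * max 0 (g (b - z)) * max 0 t)))" for b t
  have \<phi>_le: "\<phi> b t \<le> 1" for b t
    using \<open>0 \<le> s\<close> by (simp add: \<phi>_def)
  \<comment> \<open>For \<open>b\<close> other than \<open>z\<close> the path loss is positive, so
    both truncations in \<open>\<phi>\<close> are void.\<close>
  have \<phi>_exp_neg: "exp_neg (ennreal s * ennreal (t * g (b - z))) = \<phi> b t"
    if "b \<noteq> z" "0 \<le> t" for b t
    using that gpos[of "b - z"] \<open>0 \<le> s\<close>
    by (simp add: ennreal_mult[symmetric] exp_neg_ennreal \<phi>_def max_def mult_ac)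
  have \<phi>_laplace: "(\<integral>\<^sup>+t. \<phi> b t \<partial>\<mu>) = ennreal (laplace \<mu> (s * g (b - z)))" if "b \<noteq> z" for b
  proof -
    let ?c = "s * g (b - z)"
    have c: "0 \<le> ?c" using gpos[of "b - z"] that \<open>0 \<le> s\<close> by simp
    have "(\<integral>\<^sup>+t. \<phi> b t \<partial>\<mu>) = (\<integral>\<^sup>+t. ennreal (exp (- ?c * t)) \<partial>\<mu>)"
      using \<open>AE t in \<mu>. 0 \<le> t\<close> gpos[of "b - z"] that
      by (intro nn_integral_cong_AE) (auto simp: \<phi>_def max_def)
    \<comment> \<open>Without integrability the Bochner integral in \<open>laplace\<close> would be
      the default 0. The rate \<open>?c\<close> and almost every mark are nonnegative, so 1 bounds
      the integrand.\<close>
    also have "integrable \<mu> (\<lambda>t. exp (- ?c * t))"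
    proof (rule \<mu>.integrable_const_bound[where B = 1])
      show "AE t in \<mu>. norm (exp (- ?c * t)) \<le> 1"
        using \<open>AE t in \<mu>. 0 \<le> t\<close> by eventually_elim (use c in simp)
    qed measurable
    then have "(\<integral>\<^sup>+t. ennreal (exp (- ?c * t)) \<partial>\<mu>) = ennreal (laplace \<mu> ?c)"
      unfolding laplace_def by (intro nn_integral_eq_integral) auto
    finally show ?thesis .
  qed
  \<comment> \<open>The event on which both integrands are rewritten. Its last clause says that
    after recentring at any point no other point sits at \<open>z\<close>, so \<open>g 0\<close>
    never enters.\<close>
  have good: "AE \<omega> in M. bij_betw (\<lambda>n. \<xi> n \<omega>) UNIV (\<Phi> \<omega>) \<and> (\<forall>n. 0 \<le> h \<omega> (\<xi> n \<omega>)) \<and>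
      (\<forall>m n. m \<noteq> n \<longrightarrow> \<xi> m \<omega> - \<xi> n \<omega> \<noteq> z)"
    using bij hpos neyman_scott_AE_diff[OF \<open>neyman_scott M lamp c f \<Phi>\<close>, of z]
  proof eventually_elim
    case (elim \<omega>)
    have "\<xi> n \<omega> \<in> \<Phi> \<omega>" for n
      using elim(1) by (auto simp: bij_betw_def)
    moreover have "\<xi> n \<omega> \<noteq> \<xi> m \<omega>" if "m \<noteq> n" for m n
      using elim(1) that by (auto simp: bij_betw_def inj_def)
    ultimately show ?case using elim by blast
  qed
  \<comment> \<open>Recentred at \<open>\<xi> n \<omega>\<close>, the point
    \<open>\<xi> m \<omega> - \<xi> n \<omega>\<close> keeps the mark
    \<open>h \<omega> (\<xi> m \<omega>)\<close>, since the shifted marks add the centre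
    back.\<close>
  have "(\<integral>\<^sup>+\<omega>. (\<Sum>\<^sub>\<infinity>x\<in>\<Phi> \<omega> \<inter> B. exp_neg (ennreal s *
          interference ((\<lambda>y. y - x) ` \<Phi> \<omega> - {0}) (\<lambda>y. h \<omega> (y + x)) g z)) \<partial>M)
    = (\<integral>\<^sup>+\<omega>. (\<Sum>n. indicator B (\<xi> n \<omega>) *
         (INF k. \<Prod>m\<in>{..<k} - {n}. \<phi> (\<xi> m \<omega> - \<xi> n \<omega>) (h \<omega> (\<xi> m \<omega>)))) \<partial>M)"
    using good
  proof (intro nn_integral_cong_AE, eventually_elim)
    case (elim \<omega>)
    then show ?case
      unfolding exp_neg_interference
      by (subst palm_sum_enumerated[of "\<lambda>n. \<xi> n \<omega>"]) (auto simp: exp_neg_le_1 \<phi>_exp_neg \<phi>_le)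
  qed
  also have "\<dots> = (\<integral>\<^sup>+\<omega>. (\<Sum>n. indicator B (\<xi> n \<omega>) *
         (INF k. \<Prod>m\<in>{..<k} - {n}. \<integral>\<^sup>+t. \<phi> (\<xi> m \<omega> - \<xi> n \<omega>) t \<partial>\<mu>)) \<partial>M)"
    by (rule nn_integral_palm_iid_marks[OF ind \<mu> indX _ \<phi>_le \<open>B \<in> sets borel\<close>])
      (unfold \<phi>_def, measurable)
  also have "\<dots> = (\<integral>\<^sup>+\<omega>. (\<Sum>\<^sub>\<infinity>x\<in>\<Phi> \<omega> \<inter> B. unordered_prod (\<lambda>x. laplace \<mu> (s * g (x - z)))
          ((\<lambda>y. y - x) ` \<Phi> \<omega> - {0})) \<partial>M)"
    using good
  proof (intro nn_integral_cong_AE, eventually_elim)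
    case (elim \<omega>)
    \<comment> \<open>The bound 1 on the factors comes from \<open>\<phi>\<close>, for every
      \<open>b\<close>; the Laplace transform itself may exceed 1 at \<open>b = z\<close> if
      \<open>g 0\<close> is negative.\<close>
    have "(\<integral>\<^sup>+t. \<phi> b t \<partial>\<mu>) \<le> (\<integral>\<^sup>+t. 1 \<partial>\<mu>)" for b
      by (intro nn_integral_mono \<phi>_le)
    then have "(\<integral>\<^sup>+t. \<phi> b t \<partial>\<mu>) \<le> 1" for b
      by (simp add: \<mu>.emeasure_space_1)
    with elim show ?case
      unfolding unordered_prod_eq_inf_prod
      by (subst palm_sum_enumerated[of "\<lambda>n. \<xi> n \<omega>"]) (auto simp flip: \<phi>_laplace)
  qed
  \<comment> \<open>Both Palm expectations have the same normalising divisor, so equality of the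
    integrals suffices.\<close>
  finally show ?thesis
    by (simp add: cond_laplace_interference_def marked_reduced_palm_def
        cond_gen_functional_def reduced_palm_def)
qed

end
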